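(* Let $\mathcal{A}$ be the $n$-dimensional null-filiform associative algebra over $\mathbb{C}$ with basis $e_1,\dots,e_n$, and let $P_0$ be a (homogeneous) Rota-Baxter operator of weight $0$ with degree $0$ on $\mathcal{A}$, with associated function $\psi$. Then: (a) If $\psi(t)\neq 0$ for some $1\le t\le\lfloor n/2\rfloor$, then \[P_0(e_i)=\begin{cases}\frac{t\psi(t)}{i}e_i, & i\equiv 0 \ (\bmod\ t),\\ 0, & \text{otherwise;}\end{cases}\] (b) If $\psi(t)=0$ for all $1\le t\le\lfloor n/2\rfloor$, then \[P_0(e_i)=\begin{cases}\psi(r)e_r, & i=r,\\ 0, & \text{otherwise,}\end{cases}\] for some fixed $\lfloor n/2\rfloor<r\le n$.
   Context: The $n$-dimensional null-filiform associative algebra $\mathcal{A}$ over $\mathbb{C}$ has basis $e_1,\dots,e_n$ and bilinear product $e_ie_j=e_{i+j}$ if $i+j\le n$, and $e_ie_j=0$ otherwise. A homogeneous operator of degree $0$ on $\mathcal{A}$ is a linear map $P_0$ with $P_0(e_i)=\psi(i)e_i$ for $1\le i\le n$, where $\psi:\mathbb{N}\to\mathbb{C}$ is a function. A Rota-Baxter operator of weight $\lambda$ is a linear map $P:\mathcal{A}\to\mathcal{A}$ with $P(x)P(y)=P(xP(y)+P(x)y+\lambda xy)$ for all $x,y\in\mathcal{A}$.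
   Formalization: In (a) the formula is proved for t the least index with ψ(t) ≠ 0, not for every t ≤ ⌊n/2⌋ with ψ(t) ≠ 0; the latter fails, e.g. n = 4, ψ(i) = 1/i, t = 2, where the formula would give P_0(e_1) = 0. *)

theory Defs
  imports Complex_Main
begin

locale complex_assoc_algebra = vector_space scale
  for scale :: "complex \<Rightarrow> 'a::ab_group_add \<Rightarrow> 'a" (infixr \<open>*\<^sub>C\<close> 75) +
  fixes mult :: "'a \<Rightarrow> 'a \<Rightarrow> 'a" (infixl \<open>\<cdot>\<close> 70)
  assumes linear_mult_left: "Vector_Spaces.linear scale scale (\<lambda>x. x \<cdot> y)"
    and linear_mult_right: "Vector_Spaces.linear scale scale (\<lambda>y. x \<cdot> y)"
    and mult_assoc: "(x \<cdot> y) \<cdot> z = x \<cdot> (y \<cdot> z)"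

text \<open>
  The underlying vector space is the whole type \<open>'a\<close>. The basis is \<open>e 1, \<dots>, e n\<close>; values of
  \<open>e\<close> at indices outside \<open>{1..n}\<close> are irrelevant.
\<close>

locale null_filiform_algebra = complex_assoc_algebra scale mult
  for scale :: "complex \<Rightarrow> 'a::ab_group_add \<Rightarrow> 'a" (infixr \<open>*\<^sub>C\<close> 75)
    and mult :: "'a \<Rightarrow> 'a \<Rightarrow> 'a" (infixl \<open>\<cdot>\<close> 70) +
  fixes n :: nat and e :: "nat \<Rightarrow> 'a"
  assumes basis_inj: "inj_on e {1..n}"
    and basis_independent: "independent (e ` {1..n})"
    and basis_span: "span (e ` {1..n}) = UNIV"
    and mult_basis: "\<lbrakk>i \<in> {1..n}; j \<in> {1..n}\<rbrakk> \<Longrightarrow>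
           e i \<cdot> e j = (if i + j \<le> n then e (i + j) else 0)"

definition rota_baxter_operator ::
    "(complex \<Rightarrow> 'a::ab_group_add \<Rightarrow> 'a) \<Rightarrow> ('a \<Rightarrow> 'a \<Rightarrow> 'a) \<Rightarrow> complex \<Rightarrow> ('a \<Rightarrow> 'a) \<Rightarrow> bool" where
  "rota_baxter_operator scale mult wt P \<longleftrightarrow>
     Vector_Spaces.linear scale scale P \<and>
     (\<forall>x y. mult (P x) (P y) = P (mult x (P y) + mult (P x) y + scale wt (mult x y)))"

definition homogeneous_degree_0 ::
    "(complex \<Rightarrow> 'a::ab_group_add \<Rightarrow> 'a) \<Rightarrow> nat \<Rightarrow> (nat \<Rightarrow> 'a) \<Rightarrow> (nat \<Rightarrow> complex) \<Rightarrow> ('a \<Rightarrow> 'a) \<Rightarrow> bool" where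
  "homogeneous_degree_0 scale n e \<psi> P \<longleftrightarrow>
     Vector_Spaces.linear scale scale P \<and> (\<forall>i\<in>{1..n}. P (e i) = scale (\<psi> i) (e i))"

end

theory Submission
  imports Defs
begin

text \<open>
  Comparing coefficients of \<open>e (i + j)\<close> in the Rota-Baxter identity at \<open>e i\<close>, \<open>e j\<close> gives
  \<open>\<psi> i * \<psi> j = (\<psi> i + \<psi> j) * \<psi> (i + j)\<close> whenever \<open>i + j \<le> n\<close>. Let \<open>t\<close> be minimal with
  \<open>\<psi> t \<noteq> 0\<close>. Induction on \<open>k\<close> with \<open>(i, j) = (k * t, t)\<close> gives \<open>\<psi> (k * t) = \<psi> t / k\<close>, and the
  pair \<open>(k * t, s)\<close> with \<open>0 < s < t\<close> gives \<open>\<psi> (k * t + s) = 0\<close>. If \<open>\<psi>\<close> vanishes up to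
  \<open>n div 2\<close> and \<open>n div 2 < i < j \<le> n\<close>, the pair \<open>(j - i, i)\<close> gives \<open>\<psi> i * \<psi> j = 0\<close>, so at most
  one value of \<open>\<psi>\<close> is nonzero.
\<close>

context null_filiform_algebra
begin

lemma basis_nonzero: "i \<in> {1..n} \<Longrightarrow> e i \<noteq> 0"
  using basis_independent dependent_zero by (metis image_eqI)

text \<open>Both sides of the identity at \<open>e i\<close> and \<open>e j\<close> are multiples of
  \<open>e (i + j)\<close>; the bound \<open>i + j \<le> n\<close> makes this a basis vector, hence
  nonzero, so the coefficients agree.\<close>

lemma rota_baxter_weight_0_eq:
  assumes rb: "rota_baxter_operator scale mult 0 P"
    and hom: "homogeneous_degree_0 scale n e \<psi> P"
    and ij: "1 \<le> i" "1 \<le> j" "i + j \<le> n"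
  shows "\<psi> i * \<psi> j = (\<psi> i + \<psi> j) * \<psi> (i + j)"
proof -
  have P_lin: "Vector_Spaces.linear scale scale P"
    using hom by (simp add: homogeneous_degree_0_def)
  have P_basis: "P (e k) = scale (\<psi> k) (e k)" if "k \<in> {1..n}" for k
    using hom that by (simp add: homogeneous_degree_0_def)
  have in_range: "i \<in> {1..n}" "j \<in> {1..n}" "i + j \<in> {1..n}"
    using ij by auto
  have prod: "mult (e i) (e j) = e (i + j)"
    using mult_basis[OF in_range(1,2)] ij by simp
  have scale_left: "mult (scale c x) y = scale c (mult x y)" for c x y
    using module_hom.scale[OF Vector_Spaces.linear.axioms(3)[OF linear_mult_left]] .
  have scale_right: "mult x (scale c y) = scale c (mult x y)" for c x y
    using module_hom.scale[OF Vector_Spaces.linear.axioms(3)[OF linear_mult_right]] .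
  have "mult (P (e i)) (P (e j)) = scale (\<psi> i * \<psi> j) (e (i + j))"
    by (simp add: P_basis[OF in_range(1)] P_basis[OF in_range(2)] prod scale_left scale_right mult.commute)
  moreover have "mult (P (e i)) (P (e j)) = P (mult (e i) (P (e j)) + mult (P (e i)) (e j))"
    using rb by (simp add: rota_baxter_operator_def)
  moreover have "mult (e i) (P (e j)) + mult (P (e i)) (e j) = scale (\<psi> i + \<psi> j) (e (i + j))"
    by (simp add: P_basis[OF in_range(1)] P_basis[OF in_range(2)] prod scale_left scale_right scale_left_distrib add.commute)
  moreover have "P (scale (\<psi> i + \<psi> j) (e (i + j))) = scale ((\<psi> i + \<psi> j) * \<psi> (i + j)) (e (i + j))"
    by (simp only: module_hom.scale[OF Vector_Spaces.linear.axioms(3)[OF P_lin]] P_basis[OF in_range(3)] scale_scale)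
  ultimately show ?thesis
    using basis_nonzero[OF in_range(3)] by simp
qed

end

text \<open>Where the values are nonzero, the relation says that reciprocals add, so
  \<open>1 / \<psi> (k * t)\<close> is \<open>k\<close> times \<open>1 / \<psi> t\<close>.\<close>

lemma multiple_value:
  fixes \<psi> :: "nat \<Rightarrow> 'b::field_char_0"
  assumes eq: "\<And>i j. 1 \<le> i \<Longrightarrow> 1 \<le> j \<Longrightarrow> i + j \<le> n \<Longrightarrow> \<psi> i * \<psi> j = (\<psi> i + \<psi> j) * \<psi> (i + j)"
    and t: "1 \<le> t" "\<psi> t \<noteq> 0"
    and "1 \<le> k" "k * t \<le> n"
  shows "\<psi> (k * t) = \<psi> t / of_nat k"
  using \<open>1 \<le> k\<close> \<open>k * t \<le> n\<close>
proof (induction k rule: dec_induct)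
  case base
  show ?case by simp
next
  case (step k)
  have k0: "of_nat k \<noteq> (0::'b)" "of_nat (Suc k) \<noteq> (0::'b)"
    using \<open>1 \<le> k\<close> by (simp, simp only: of_nat_eq_0_iff)
  have IH: "\<psi> (k * t) = \<psi> t / of_nat k"
    using step by simp
  have "\<psi> (k * t) * \<psi> t = (\<psi> (k * t) + \<psi> t) * \<psi> (k * t + t)"
    using step.hyps step.prems t by (intro eq) (auto simp: add.commute)
  \<comment> \<open>By the induction hypothesis the sum \<open>\<psi> (k * t) + \<psi> t\<close> is
    \<open>\<psi> t * (k + 1) / k\<close>, so a factor \<open>\<psi> t\<close> splits off on both
    sides.\<close>
  then have "\<psi> t * (\<psi> t / of_nat k) = \<psi> t * (of_nat (Suc k) / of_nat k * \<psi> (k * t + t))"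
    using k0 by (simp add: IH field_simps)
  then have "\<psi> t / of_nat k = of_nat (Suc k) / of_nat k * \<psi> (k * t + t)"
    using t(2) mult_left_cancel by blast
  then have "\<psi> t = of_nat (Suc k) * \<psi> (k * t + t)"
    using k0(1) by (simp only: times_divide_eq_left divide_cancel_right) simp
  then show ?case
    using k0(2) by (simp only: mult_Suc add.commute[of t]) (simp add: field_simps)
qed

text \<open>The remainder of \<open>i\<close> modulo \<open>t\<close> is a positive index below
  \<open>t\<close>, where \<open>\<psi>\<close> vanishes. This collapses the relation to a vanishing
  product whose other factor \<open>\<psi> (k * t)\<close> is nonzero.\<close>

lemma nonmultiple_value:
  fixes \<psi> :: "nat \<Rightarrow> 'b::field_char_0"
  assumes eq: "\<And>i j. 1 \<le> i \<Longrightarrow> 1 \<le> j \<Longrightarrow> i + j \<le> n \<Longrightarrow> \<psi> i * \<psi> j = (\<psi> i + \<psi> j) * \<psi> (i + j)"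
    and t: "1 \<le> t" "\<psi> t \<noteq> 0"
    and min: "\<And>s. 1 \<le> s \<Longrightarrow> s < t \<Longrightarrow> \<psi> s = 0"
    and i: "i \<le> n" "i mod t \<noteq> 0"
  shows "\<psi> i = 0"
proof (cases "i < t")
  case True
  \<comment> \<open>The index 0 is excluded because it is a multiple of \<open>t\<close>.\<close>
  then show ?thesis using min i by (cases i) auto
next
  case False
  define k s where "k = i div t" and "s = i mod t"
  have i_eq: "i = k * t + s"
    by (simp add: k_def s_def)
  have k: "1 \<le> k"
    using False t(1) by (simp add: k_def Suc_le_eq div_greater_zero_iff)
  have s: "1 \<le> s" "s < t"
    using i(2) t(1) by (auto simp: s_def)
  have "\<psi> (k * t) = \<psi> t / of_nat k"
    using i(1) i_eq by (intro multiple_value[where n = n] eq t k) auto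
  then have "\<psi> (k * t) \<noteq> 0"
    using t(2) k by simp
  moreover have "\<psi> (k * t) * \<psi> s = (\<psi> (k * t) + \<psi> s) * \<psi> (k * t + s)"
    using i(1) i_eq k s by (intro eq) auto
  ultimately show ?thesis
    using min[OF s] i_eq by simp
qed

lemma upper_half_value_unique:
  fixes \<psi> :: "nat \<Rightarrow> 'b::field"
  assumes eq: "\<And>i j. 1 \<le> i \<Longrightarrow> 1 \<le> j \<Longrightarrow> i + j \<le> n \<Longrightarrow> \<psi> i * \<psi> j = (\<psi> i + \<psi> j) * \<psi> (i + j)"
    and zero: "\<And>s. 1 \<le> s \<Longrightarrow> s \<le> n div 2 \<Longrightarrow> \<psi> s = 0"
    and ij: "n div 2 < i" "i < j" "j \<le> n"
  shows "\<psi> i = 0 \<or> \<psi> j = 0"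
proof -
  \<comment> \<open>The gap lies in the lower half:
    \<open>j - i \<le> n - (n div 2 + 1) \<le> n div 2\<close>.\<close>
  have "\<psi> (j - i) = 0"
    using ij by (intro zero) auto
  moreover have "\<psi> (j - i) * \<psi> i = (\<psi> (j - i) + \<psi> i) * \<psi> (j - i + i)"
    using ij by (intro eq) auto
  ultimately show ?thesis
    using ij by simp
qed

theorem theorem3p4:
  fixes scale :: "complex \<Rightarrow> 'a::ab_group_add \<Rightarrow> 'a"
    and mult :: "'a \<Rightarrow> 'a \<Rightarrow> 'a"
    and n :: nat
    and e :: "nat \<Rightarrow> 'a"
    and P\<^sub>0 :: "'a \<Rightarrow> 'a"
    and \<psi> :: "nat \<Rightarrow> complex"
  assumes "n \<ge> 1"
    and "null_filiform_algebra scale mult n e"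
    and "rota_baxter_operator scale mult 0 P\<^sub>0"
    and "homogeneous_degree_0 scale n e \<psi> P\<^sub>0"
  shows "((\<exists>t\<in>{1..n div 2}. \<psi> t \<noteq> 0) \<longrightarrow>
           (\<exists>t\<in>{1..n div 2}. \<psi> t \<noteq> 0 \<and> (\<forall>s\<in>{1..<t}. \<psi> s = 0) \<and>
              (\<forall>i\<in>{1..n}. P\<^sub>0 (e i) =
                 (if i mod t = 0 then scale (of_nat t * \<psi> t / of_nat i) (e i) else 0))))
       \<and> ((\<forall>t\<in>{1..n div 2}. \<psi> t = 0) \<longrightarrow>
           (\<exists>r\<in>{n div 2<..n}. \<forall>i\<in>{1..n}. P\<^sub>0 (e i) =
                 (if i = r then scale (\<psi> r) (e r) else 0)))"
proof -
  interpret null_filiform_algebra scale mult n e by fact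
  note eq = rota_baxter_weight_0_eq[OF assms(3,4)]
  have P: "P\<^sub>0 (e i) = scale (\<psi> i) (e i)" if "i \<in> {1..n}" for i
    using assms(4) that by (simp add: homogeneous_degree_0_def)
  show ?thesis
  proof (intro conjI impI)
    assume ex: "\<exists>t\<in>{1..n div 2}. \<psi> t \<noteq> 0"
    \<comment> \<open>The least index is essential: for any larger one the formula would send
      \<open>e\<close> at the least index to 0.\<close>
    define t where "t = (LEAST t. t \<in> {1..n div 2} \<and> \<psi> t \<noteq> 0)"
    have t: "t \<in> {1..n div 2}" "\<psi> t \<noteq> 0"
      using LeastI_ex[of "\<lambda>t. t \<in> {1..n div 2} \<and> \<psi> t \<noteq> 0"] ex unfolding t_def by blast+
    have min: "\<psi> s = 0" if "1 \<le> s" "s < t" for s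
      using not_less_Least[of s "\<lambda>t. t \<in> {1..n div 2} \<and> \<psi> t \<noteq> 0"] that t(1) by (auto simp: t_def)
    have "\<psi> i = (if i mod t = 0 then of_nat t * \<psi> t / of_nat i else 0)" if i: "i \<in> {1..n}" for i
    proof (cases "i mod t = 0")
      case True
      then obtain k where k: "i = k * t" by (metis dvd_def mod_0_imp_dvd mult.commute)
      \<comment> \<open>Since \<open>i = k * t\<close>, this is \<open>t * \<psi> t / i\<close>;
        \<open>k = 0\<close> cannot occur because \<open>i \<ge> 1\<close>.\<close>
      then have "\<psi> i = \<psi> t / of_nat k"
        using i t multiple_value[where n = n and t = t and k = k, OF eq] by (cases k) auto
      then show ?thesis using k t by simp
    next
      case False
      then show ?thesis using nonmultiple_value[where n = n and t = t and i = i, OF eq] t min i by auto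
    qed
    then have "\<forall>i\<in>{1..n}. P\<^sub>0 (e i) =
        (if i mod t = 0 then scale (of_nat t * \<psi> t / of_nat i) (e i) else 0)"
      using P by (metis scale_zero_left)
    then show "\<exists>t\<in>{1..n div 2}. \<psi> t \<noteq> 0 \<and> (\<forall>s\<in>{1..<t}. \<psi> s = 0) \<and>
        (\<forall>i\<in>{1..n}. P\<^sub>0 (e i) =
          (if i mod t = 0 then scale (of_nat t * \<psi> t / of_nat i) (e i) else 0))"
      using t min by (intro bexI[of _ t]) auto
  next
    assume zero: "\<forall>t\<in>{1..n div 2}. \<psi> t = 0"
    have unique: "i = j" if "i \<in> {1..n}" "j \<in> {1..n}" "\<psi> i \<noteq> 0" "\<psi> j \<noteq> 0" for i j
    proof -
      have "n div 2 < i" "n div 2 < j"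
        using that zero by (auto simp: not_le[symmetric])
      then show ?thesis
        using that zero upper_half_value_unique[where n = n and i = i and j = j, OF eq]
          upper_half_value_unique[where n = n and i = j and j = i, OF eq]
        by (cases i j rule: linorder_cases) auto
    qed
    obtain r where r: "r \<in> {n div 2<..n}" "\<forall>i\<in>{1..n}. i \<noteq> r \<longrightarrow> \<psi> i = 0"
    proof (cases "\<exists>r\<in>{1..n}. \<psi> r \<noteq> 0")
      case True
      then obtain r where r: "r \<in> {1..n}" "\<psi> r \<noteq> 0" by blast
      then have "r \<in> {n div 2<..n}"
        using zero by (auto simp: not_le[symmetric])
      then show ?thesis
        using that[of r] unique r by blast
    next
      case False
      \<comment> \<open>If \<open>\<psi>\<close> vanishes on all of \<open>{1..n}\<close>, any
        upper-half index serves as \<open>r\<close>; \<open>n\<close> is one, as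
        \<open>n div 2 < n\<close> for \<open>n \<ge> 1\<close>.\<close>
      then show ?thesis using that[of n] \<open>n \<ge> 1\<close> by auto
    qed
    then show "\<exists>r\<in>{n div 2<..n}. \<forall>i\<in>{1..n}. P\<^sub>0 (e i) =
        (if i = r then scale (\<psi> r) (e r) else 0)"
      using P by (intro bexI[of _ r]) auto
  qed
qed

end
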